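(* Let $O=(\rho,\gamma)$ be an object with $\rho,\gamma$ of full rank and let $H$ be the Hamiltonian corresponding to $\gamma$. Let $Q=(\sigma,\sigma)$ be a qubit with energy gap $E>0$ in equilibrium at the reference inverse temperature $\beta$, i.e. $\sigma=\frac{1}{1+e^{-\beta E}}\,\mathrm{diag}(1,e^{-\beta E})$. Then $O$ can be used for cooling $Q$, i.e. there is a unitary $u$ commuting with $\gamma\otimes\sigma$ such that $$\mathrm{tr}\big(u(\rho\otimes\sigma)u^*(1\otimes\sigma_z)\big)>\mathrm{tr}(\sigma\sigma_z),$$ if and only if there is a pair $|i\rangle,|j\rangle$ of (unit) eigenvectors of $H$ with different eigenvalues $E_i,E_j$ such that $E_i-E_j=E$ and $$\beta_{|i\rangle,|j\rangle}>\beta .$$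
   Context: Fix a reference inverse temperature $\beta\in\mathbb{R}$, $\beta\neq0$. An object is a pair $(\rho,\gamma)$ of density matrices on a finite-dimensional complex Hilbert space, where $\gamma$ (the equilibrium state) has full rank. The corresponding Hamiltonian $H$ is the selfadjoint operator, unique up to adding a multiple of the identity, with $\gamma=e^{-\beta H}/\mathrm{tr}(e^{-\beta H})$. Write $\sigma_z=\mathrm{diag}(1,-1)$; the qubit Hamiltonian is $\mathrm{diag}(0,E)$, so the first basis vector is the lower level. For unit eigenvectors $|i\rangle,|j\rangle$ of $\gamma$ whose $H$-eigenvalues $E_i,E_j$ are different, the relative inverse temperature is $$\beta_{|i\rangle,|j\rangle}:=\frac{\ln\langle i|\rho|i\rangle-\ln\langle j|\rho|j\rangle}{E_j-E_i}.$$ *)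

theory Defs
  imports "HOL-Analysis.Analysis"
begin

text \<open>
  The Hilbert space of dimension \<open>CARD('n)\<close> is \<open>complex^'n\<close>, and operators on it are matrices
  of type \<open>complex^'n^'n\<close>. The library operations \<open>*\<close> and \<open>^\<close> on this type are componentwise;
  the operator product is \<open>**\<close>.
\<close>

definition braket :: "complex^'n \<Rightarrow> complex^'n \<Rightarrow> complex" where
  "braket x y = (\<Sum>i\<in>UNIV. cnj (x $ i) * y $ i)"

definition hconj :: "complex^'n^'n \<Rightarrow> complex^'n^'n" where
  "hconj A = (\<chi> i j. cnj (A $ j $ i))"

definition selfadjoint :: "complex^'n^'n \<Rightarrow> bool" where
  "selfadjoint A \<longleftrightarrow> hconj A = A"

definition unitary :: "complex^'n^'n \<Rightarrow> bool" where
  "unitary u \<longleftrightarrow> u ** hconj u = mat 1 \<and> hconj u ** u = mat 1"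

definition density_matrix :: "complex^'n^'n \<Rightarrow> bool" where
  "density_matrix A \<longleftrightarrow>
     selfadjoint A \<and> (\<forall>x. 0 \<le> Re (braket x (A *v x))) \<and> trace A = 1"

definition full_rank :: "complex^'n^'n \<Rightarrow> bool" where
  "full_rank A \<longleftrightarrow> rank A = CARD('n)"

text \<open>Pairs (state, equilibrium state).\<close>
definition object :: "complex^'n^'n \<Rightarrow> complex^'n^'n \<Rightarrow> bool" where
  "object \<rho> \<gamma> \<longleftrightarrow> density_matrix \<rho> \<and> density_matrix \<gamma> \<and> full_rank \<gamma>"

primrec mpow :: "complex^'n^'n \<Rightarrow> nat \<Rightarrow> complex^'n^'n" where
  "mpow A 0 = mat 1"
| "mpow A (Suc k) = A ** mpow A k"

definition mexp :: "complex^'n^'n \<Rightarrow> complex^'n^'n" where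
  "mexp A = (\<Sum>k. mpow A k /\<^sub>R fact k)"

text \<open>For given \<open>\<beta> \<noteq> 0\<close> and \<open>\<gamma>\<close>, this determines \<open>H\<close> only up to a real multiple of the
  identity.\<close>
definition hamiltonian_of :: "real \<Rightarrow> complex^'n^'n \<Rightarrow> complex^'n^'n \<Rightarrow> bool" where
  "hamiltonian_of \<beta> \<gamma> H \<longleftrightarrow>
     selfadjoint H \<and>
     \<gamma> = (\<chi> i j. mexp ((- \<beta>) *\<^sub>R H) $ i $ j / trace (mexp ((- \<beta>) *\<^sub>R H)))"

definition tensor :: "complex^'n^'n \<Rightarrow> complex^'m^'m \<Rightarrow> complex^('n \<times> 'm)^('n \<times> 'm)"
    (infixl "\<otimes>\<^sub>m" 72) where
  "A \<otimes>\<^sub>m B = (\<chi> p q. A $ fst p $ fst q * B $ snd p $ snd q)"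

text \<open>The first qubit basis vector, at index \<open>1\<close>, is the ground state of \<open>diag2 0 E\<close>.\<close>
definition diag2 :: "complex \<Rightarrow> complex \<Rightarrow> complex^2^2" where
  "diag2 a b = vector [vector [a, 0], vector [0, b]]"

definition sigma_z :: "complex^2^2" where
  "sigma_z = diag2 1 (- 1)"

definition qubit_gibbs :: "real \<Rightarrow> real \<Rightarrow> complex^2^2" where
  "qubit_gibbs \<beta> E =
     (1 / (1 + exp (- \<beta> * E))) *\<^sub>R diag2 1 (complex_of_real (exp (- \<beta> * E)))"

text \<open>The object \<open>(\<rho>, \<gamma>)\<close> can be used for cooling the qubit \<open>(\<sigma>, \<sigma>)\<close>. Both traces are real
  when \<open>\<rho>\<close> and \<open>\<sigma>\<close> are selfadjoint, so comparing real parts loses nothing.\<close>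
definition can_cool :: "complex^'n^'n \<Rightarrow> complex^'n^'n \<Rightarrow> complex^2^2 \<Rightarrow> bool" where
  "can_cool \<rho> \<gamma> \<sigma> \<longleftrightarrow>
     (\<exists>u. unitary u \<and> u ** (\<gamma> \<otimes>\<^sub>m \<sigma>) = (\<gamma> \<otimes>\<^sub>m \<sigma>) ** u \<and>
          Re (trace (u ** (\<rho> \<otimes>\<^sub>m \<sigma>) ** hconj u ** (mat 1 \<otimes>\<^sub>m sigma_z)))
            > Re (trace (\<sigma> ** sigma_z)))"

definition unit_eigenvector :: "complex^'n^'n \<Rightarrow> real \<Rightarrow> complex^'n \<Rightarrow> bool" where
  "unit_eigenvector H e x \<longleftrightarrow> norm x = 1 \<and> H *v x = complex_of_real e *s x"

text \<open>The relative inverse temperature of the vectors \<open>x\<close>, \<open>y\<close> with energies \<open>ex\<close>, \<open>ey\<close>.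
  Meaningful for \<open>ex \<noteq> ey\<close> and positive \<open>\<langle>x|\<rho>|x\<rangle>\<close>, \<open>\<langle>y|\<rho>|y\<rangle>\<close>; these are real
  for selfadjoint \<open>\<rho>\<close>.\<close>
definition rel_inv_temp ::
    "complex^'n^'n \<Rightarrow> complex^'n \<Rightarrow> real \<Rightarrow> complex^'n \<Rightarrow> real \<Rightarrow> real" where
  "rel_inv_temp \<rho> x ex y ey =
     (ln (Re (braket x (\<rho> *v x))) - ln (Re (braket y (\<rho> *v y)))) / (ey - ex)"

end

theory Submission
  imports Defs
begin

text \<open>
  Both directions compare populations on degenerate levels of \<open>\<gamma> \<otimes> \<sigma>\<close>. The vectors \<open>x \<otimes> |0\<rangle>\<close>
  and \<open>y \<otimes> |1\<rangle>\<close> are degenerate exactly if the energy of \<open>x\<close> exceeds that of \<open>y\<close> by \<open>E\<close>, and then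
  \<open>\<beta>\<^bsub>x,y\<^esub> > \<beta>\<close> says that the second one is more populated in \<open>\<rho> \<otimes> \<sigma>\<close>; the unitary exchanging
  them cools the qubit. Conversely, choose an orthonormal eigenbasis of \<open>H\<close> in which \<open>\<rho>\<close> is diagonal
  on every eigenspace. In the resulting product basis, an energy conserving unitary acts on the
  populations as a doubly stochastic matrix that only connects vectors of equal total energy. If no
  pair has relative inverse temperature above \<open>\<beta>\<close>, then at each energy all populations with
  the qubit in the ground state are at least those with the excited qubit, and no such matrix can
  increase the total weight on the ground state.
\<close>

section \<open>The complex inner product and rank-one operators\<close>

lemma braket_simps:
  "braket (x + y) z = braket x z + braket y z" "braket x (y + z) = braket x y + braket x z"
  "braket (x - y) z = braket x z - braket y z" "braket x (y - z) = braket x y - braket x z"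
  "braket (c *s x) y = cnj c * braket x y" "braket x (c *s y) = c * braket x y"
  "braket 0 x = 0" "braket x 0 = 0"
  by (simp_all add: braket_def sum.distrib sum_subtractf algebra_simps sum_distrib_left)

lemma braket_sum_right: "braket x (\<Sum>i\<in>I. f i) = (\<Sum>i\<in>I. braket x (f i))"
  by (induction I rule: infinite_finite_induct) (simp_all add: braket_simps)

lemma cnj_braket: "cnj (braket x y) = braket y x"
  by (simp add: braket_def mult.commute)

lemma Re_braket_commute: "Re (braket x y) = Re (braket y x)"
  by (subst cnj_braket[symmetric]) simp

lemma braket_self: "braket x x = complex_of_real ((norm x)\<^sup>2)"
  by (simp add: braket_def norm_vec_def L2_set_def sum_nonneg complex_norm_square mult.commute
      del: of_real_power)

lemma norm_one_iff_braket: "norm x = 1 \<longleftrightarrow> braket x x = 1"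
  by (simp add: braket_self abs_square_eq_1 del: of_real_power)

lemma matrix_vector_mult_scale: "A *v (c *s x) = c *s (A *v x)"
  for A :: "complex^'n^'m"
  by (simp add: vec_eq_iff matrix_vector_mult_def sum_distrib_left mult_ac)

lemma matrix_vector_mult_sum: "A *v (\<Sum>i\<in>I. f i) = (\<Sum>i\<in>I. A *v f i)"
  for A :: "complex^'n^'m"
  by (induction I rule: infinite_finite_induct) (simp_all add: algebra_simps)

lemma sum_matrix_vector_mult: "(\<Sum>i\<in>I. F i) *v x = (\<Sum>i\<in>I. F i *v x)"
  for F :: "'i \<Rightarrow> complex^'n^'m"
  by (induction I rule: infinite_finite_induct) (simp_all add: algebra_simps)

lemma braket_hconj: "braket x (A *v y) = braket (hconj A *v x) y"
  by (simp add: braket_def hconj_def matrix_vector_mult_def sum_distrib_left sum_distrib_right mult_ac)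
    (rule sum.swap)

lemma braket_selfadjoint: "selfadjoint A \<Longrightarrow> braket x (A *v y) = braket (A *v x) y"
  by (simp add: braket_hconj selfadjoint_def)

text \<open>The operator |x><y| of bra-ket notation.\<close>

definition outer :: "complex^'n \<Rightarrow> complex^'n \<Rightarrow> complex^'n^'n" where
  "outer x y = (\<chi> i j. x $ i * cnj (y $ j))"

lemma outer_mult_vec: "outer x y *v z = braket y z *s x"
  by (simp add: vec_eq_iff outer_def matrix_vector_mult_def braket_def sum_distrib_left mult_ac)

lemma trace_outer: "trace (outer x y) = braket y x"
  by (simp add: trace_def outer_def braket_def mult_ac)

lemma mult_outer: "A ** outer x y = outer (A *v x) y"
  by (simp add: vec_eq_iff outer_def matrix_matrix_mult_def matrix_vector_mult_def
      sum_distrib_left sum_distrib_right mult_ac)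

lemma trace_sum: "trace (\<Sum>i\<in>I. F i) = (\<Sum>i\<in>I. trace (F i))"
  for F :: "'i \<Rightarrow> complex^'n^'n"
  by (simp add: trace_def) (rule sum.swap)

section \<open>Orthonormal bases of complex subspaces\<close>

text \<open>Completeness is encoded as the expansion formula, the form in which bases are applied
  below. The family is indexed so that coordinate and product bases fit; a set of vectors serves as
  its own index set through \<open>id\<close>.\<close>

definition onb :: "'i set \<Rightarrow> ('i \<Rightarrow> complex^'n) \<Rightarrow> (complex^'n) set \<Rightarrow> bool" where
  "onb I f V \<longleftrightarrow> finite I \<and> f ` I \<subseteq> V \<and>
     (\<forall>i\<in>I. \<forall>j\<in>I. braket (f i) (f j) = (if i = j then 1 else 0)) \<and>
     (\<forall>v\<in>V. v = (\<Sum>i\<in>I. braket (f i) v *s f i))"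

lemma onbD:
  assumes "onb I f V"
  shows "finite I" "i \<in> I \<Longrightarrow> f i \<in> V"
    and "i \<in> I \<Longrightarrow> j \<in> I \<Longrightarrow> braket (f i) (f j) = (if i = j then 1 else 0)"
    and "v \<in> V \<Longrightarrow> (\<Sum>i\<in>I. braket (f i) v *s f i) = v"
  using assms by (auto simp: onb_def)

lemma onb_matrix_eqI:
  assumes "onb I f UNIV" and "\<And>i. i \<in> I \<Longrightarrow> A *v f i = B *v f i"
  shows "A = B"
  unfolding matrix_eq
proof
  fix x
  have "A *v (\<Sum>i\<in>I. braket (f i) x *s f i) = B *v (\<Sum>i\<in>I. braket (f i) x *s f i)"
    using assms(2) by (simp add: matrix_vector_mult_sum matrix_vector_mult_scale)
  then show "A *v x = B *v x"
    by (simp add: onbD(4)[OF assms(1)])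
qed

lemma onb_parseval:
  assumes "onb I f UNIV"
  shows "braket x y = (\<Sum>i\<in>I. braket x (f i) * braket (f i) y)"
proof -
  have "braket x y = braket x (\<Sum>i\<in>I. braket (f i) y *s f i)"
    by (simp add: onbD(4)[OF assms])
  then show ?thesis
    by (simp add: braket_sum_right braket_simps mult_ac)
qed

text \<open>The expansion \<open>A\<close> = sum of |A f_i><f_i| reduces the trace to that of
  rank-one operators.\<close>

lemma onb_trace:
  assumes "onb I f UNIV"
  shows "trace A = (\<Sum>i\<in>I. braket (f i) (A *v f i))"
proof -
  have "A = (\<Sum>i\<in>I. outer (A *v f i) (f i))"
    by (rule onb_matrix_eqI[OF assms])
      (simp add: sum_matrix_vector_mult outer_mult_vec onbD[OF assms] if_distrib[of "\<lambda>c. c *s _"]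
        sum.delta cong: if_cong)
  then have "trace A = trace (\<Sum>i\<in>I. outer (A *v f i) (f i))" by simp
  then show ?thesis by (simp add: trace_sum trace_outer)
qed

section \<open>Diagonalisation by maximising quadratic forms\<close>

lemma quadratic_nonpos_imp_linear_zero:
  fixes a c :: real
  assumes "\<And>t. t * a + t\<^sup>2 * c \<le> 0"
  shows "a = 0"
proof (rule ccontr)
  assume "a \<noteq> 0"
  \<comment> \<open>Because \<open>d + c > 0\<close>, the point \<open>a / d\<close> is close enough
    to 0 for the linear term to dominate, and the expression is positive there.\<close>
  define d where "d = 1 + \<bar>c\<bar>"
  have d: "d > 0" "d + c > 0" by (auto simp: d_def)
  define t where "t = a / d"
  have "t * a + t\<^sup>2 * c = a\<^sup>2 * (d + c) / d\<^sup>2"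
    using d by (simp add: t_def field_simps power2_eq_square)
  moreover have "\<dots> > 0"
    using d \<open>a \<noteq> 0\<close> by simp
  ultimately show False using assms[of t] by linarith
qed

text \<open>The first variation of \<open>w \<mapsto> \<langle>w|A|w\<rangle> - m \<langle>w|w\<rangle>\<close> vanishes at a maximiser; varying in the
  directions \<open>v\<close> and \<open>\<i> v\<close> captures the real and the imaginary part.\<close>
lemma maximiser_stationary:
  fixes A :: "complex^'n^'n"
  assumes A: "selfadjoint A" and V: "vec.subspace V" and x: "x \<in> V"
    and max: "\<And>w. w \<in> V \<Longrightarrow> Re (braket w (A *v w)) \<le> m * Re (braket w w)"
    and eq: "Re (braket x (A *v x)) = m * Re (braket x x)"
    and v: "v \<in> V"
  shows "braket v (A *v x) = of_real m * braket v x"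
proof -
  have re: "Re (braket v (A *v x)) = m * Re (braket v x)" if v: "v \<in> V" for v
  proof -
    have "t * (2 * (Re (braket v (A *v x)) - m * Re (braket v x)))
        + t\<^sup>2 * (Re (braket v (A *v v)) - m * Re (braket v v)) \<le> 0" for t
    proof -
      have s: "Re (braket x (A *v v)) = Re (braket v (A *v x))" "Re (braket x v) = Re (braket v x)"
        by (simp_all add: Re_braket_commute[of x] flip: braket_selfadjoint[OF A])
      have "x + of_real t *s v \<in> V"
        using V x v by (simp add: vec.subspace_add vec.subspace_scale)
      from max[OF this] show ?thesis
        using eq s
        by (simp add: braket_simps matrix_vector_right_distrib matrix_vector_mult_scale
            algebra_simps power2_eq_square)
    qed
    from quadratic_nonpos_imp_linear_zero[OF this] show ?thesis by simp
  qed
  have "\<i> *s v \<in> V" using V v by (simp add: vec.subspace_scale)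
  from re[OF this] re[OF v] show ?thesis
    by (simp add: complex_eq_iff braket_simps)
qed

text \<open>The unit sphere of \<open>V\<close> is compact, so the quadratic form attains its
  maximum \<open>m\<close> on it. Homogeneity of degree two turns this into the bound on all of
  \<open>V\<close> that \<open>maximiser_stationary\<close> requires.\<close>

lemma exists_maximiser:
  fixes A :: "complex^'n^'n"
  assumes V: "vec.subspace V" and "V \<noteq> {0}"
  obtains x m where "x \<in> V" "norm x = 1" "Re (braket x (A *v x)) = m * Re (braket x x)"
    and "\<And>w. w \<in> V \<Longrightarrow> Re (braket w (A *v w)) \<le> m * Re (braket w w)"
proof -
  \<comment> \<open>A complex subspace is also a real one, which gives closedness and hence
    compactness of its unit sphere.\<close>
  have scaleR: "c *\<^sub>R w = complex_of_real c *s w" for c and w :: "complex^'n"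
    by (simp add: vec_eq_iff scaleR_conv_of_real[where 'a = complex])
  have "subspace V"
    using V by (simp add: subspace_def vec.subspace_def scaleR)
  then have "compact (V \<inter> sphere 0 1)"
    by (intro closed_Int_compact closed_subspace) auto
  moreover have "V \<inter> sphere 0 1 \<noteq> {}"
  proof -
    obtain w where "w \<in> V" "w \<noteq> 0" using assms vec.subspace_0[OF V] by blast
    then have "(1 / norm w) *\<^sub>R w \<in> V \<inter> sphere 0 1"
      using \<open>subspace V\<close> by (simp add: subspace_scale)
    then show ?thesis by blast
  qed
  moreover have "continuous_on (V \<inter> sphere 0 1) (\<lambda>w. Re (braket w (A *v w)))"
    unfolding braket_def matrix_vector_mult_def
    by (intro continuous_intros)
  ultimately have "\<exists>x\<in>V \<inter> sphere 0 1. \<forall>w\<in>V \<inter> sphere 0 1.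
      Re (braket w (A *v w)) \<le> Re (braket x (A *v x))"
    by (rule continuous_attains_sup)
  then obtain x where x: "x \<in> V" "norm x = 1"
    and max: "\<And>w. w \<in> V \<Longrightarrow> norm w = 1 \<Longrightarrow> Re (braket w (A *v w)) \<le> Re (braket x (A *v x))"
    by auto
  have "Re (braket w (A *v w)) \<le> Re (braket x (A *v x)) * Re (braket w w)" if "w \<in> V" for w
  proof (cases "w = 0")
    case False
    define z where "z = (1 / norm w) *\<^sub>R w"
    have z: "z \<in> V" "norm z = 1"
      using \<open>subspace V\<close> that False by (simp_all add: z_def subspace_scale)
    have w: "w = of_real (norm w) *s z"
      using False by (simp add: z_def vec_eq_iff scaleR_conv_of_real[where 'a = complex])
    have "Re (braket w (A *v w)) = (norm w)\<^sup>2 * Re (braket z (A *v z))"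
      by (subst (1 2) w) (simp add: braket_simps matrix_vector_mult_scale power2_eq_square)
    also have "\<dots> \<le> (norm w)\<^sup>2 * Re (braket x (A *v x))"
      using max[OF z] by (simp add: mult_left_mono)
    finally show ?thesis by (simp add: braket_self mult.commute del: of_real_power)
  qed (simp add: braket_simps)
  with x show ?thesis
    by (intro that[of x "Re (braket x (A *v x))"]) (auto simp: braket_self)
qed

text \<open>\<open>V\<close> need not be invariant under \<open>A\<close>, so it is the compression
  of \<open>A\<close> to \<open>V\<close> that becomes diagonal. At a unit maximiser
  \<open>x\<close> of the quadratic form, stationarity makes \<open>A *v x - m *s x\<close>
  orthogonal to \<open>V\<close>. Hence \<open>A\<close> has no matrix elements between
  \<open>x\<close> and its orthogonal complement in \<open>V\<close>, and induction on the dimension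
  treats that complement.\<close>

lemma exists_diagonalising_onb:
  fixes A :: "complex^'n^'n"
  assumes A: "selfadjoint A" and V: "vec.subspace V"
  obtains B where "onb B id V"
    and "\<And>x y. x \<in> B \<Longrightarrow> y \<in> B \<Longrightarrow> x \<noteq> y \<Longrightarrow> braket x (A *v y) = 0"
proof -
  have "\<exists>B. onb B id V \<and> (\<forall>x\<in>B. \<forall>y\<in>B. x \<noteq> y \<longrightarrow> braket x (A *v y) = 0)"
    using V
  proof (induction "vec.dim V" arbitrary: V rule: less_induct)
    case less
    show ?case
    proof (cases "V = {0}")
      case True
      then have "onb {} id V" by (simp add: onb_def)
      then show ?thesis by blast
    next
      case False
      from exists_maximiser[OF less.prems False, of A]
      obtain x m where x: "x \<in> V" "norm x = 1" "Re (braket x (A *v x)) = m * Re (braket x x)"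
        and m: "\<And>w. w \<in> V \<Longrightarrow> Re (braket w (A *v w)) \<le> m * Re (braket w w)" by blast
      have xx: "braket x x = 1" using x(2) by (simp add: norm_one_iff_braket)
      have off: "braket v (A *v x) = of_real m * braket v x" if "v \<in> V" for v
        using maximiser_stationary[OF A less.prems x(1) m x(3) that] .
      define W where "W = {v \<in> V. braket x v = 0}"
      have W: "vec.subspace W"
        using less.prems by (simp add: W_def vec.subspace_def braket_simps)
      have "vec.dim W < vec.dim V"
      proof (rule vec.dim_psubset)
        have "W \<subseteq> V" "x \<notin> W" using xx by (auto simp: W_def)
        with x(1) have "W \<subset> V" by blast
        then show "vec.span W \<subset> vec.span V"
          using W less.prems by (metis vec.span_eq_iff)
      qed
      from less.hyps[OF this W] obtain B where B: "onb B id W"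
        and diag: "\<forall>y\<in>B. \<forall>z\<in>B. y \<noteq> z \<longrightarrow> braket y (A *v z) = 0" by blast
      have BW: "B \<subseteq> W" using onbD(2)[OF B] by auto
      have xB: "x \<notin> B" using BW xx by (auto simp: W_def)
      have orth: "braket x y = 0" "braket y x = 0" if "y \<in> B" for y
        using BW that cnj_braket[of x y] by (auto simp: W_def)
      have "onb (insert x B) id V"
        unfolding onb_def
      proof (intro conjI ballI)
        show "finite (insert x B)" "id ` insert x B \<subseteq> V"
          using onbD(1)[OF B] BW x(1) by (auto simp: W_def)
        show "braket (id y) (id z) = (if y = z then 1 else 0)"
          if "y \<in> insert x B" "z \<in> insert x B" for y z
          using that xB xx orth onbD(3)[OF B, of y z] by auto
        fix v assume "v \<in> V"
        then have "v - braket x v *s x \<in> W"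
          using less.prems x(1) xx
          by (simp add: W_def vec.subspace_diff vec.subspace_scale braket_simps)
        from onbD(4)[OF B this]
        have "(\<Sum>y\<in>B. braket y v *s y) = v - braket x v *s x"
          by (simp add: braket_simps orth cong: sum.cong)
        then show "v = (\<Sum>y\<in>insert x B. braket (id y) v *s id y)"
          using xB onbD(1)[OF B] by simp
      qed
      moreover have "\<forall>y\<in>insert x B. \<forall>z\<in>insert x B. y \<noteq> z \<longrightarrow> braket y (A *v z) = 0"
      proof -
        have "braket y (A *v x) = 0" "braket x (A *v y) = 0" if "y \<in> B" for y
        proof -
          show "braket y (A *v x) = 0"
            using off[of y] orth[OF that] BW that by (auto simp: W_def)
          then show "braket x (A *v y) = 0"
            by (metis A braket_selfadjoint cnj_braket complex_cnj_zero)
        qed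
        then show ?thesis using diag by auto
      qed
      ultimately show ?thesis by blast
    qed
  qed
  then show ?thesis using that by blast
qed

section \<open>Resolutions of the identity and eigenbases\<close>

lemma onb_resolution:
  assumes "onb I f UNIV"
  shows "(\<Sum>i\<in>I. outer (f i) (f i)) = mat 1"
  by (rule onb_matrix_eqI[OF assms])
    (simp add: sum_matrix_vector_mult outer_mult_vec onbD(4)[OF assms])

text \<open>Completeness becomes an operator identity, which can be checked on another basis or
  factor by factor in a tensor product.\<close>

lemma onb_of_resolution:
  assumes "finite I" "\<And>i j. i \<in> I \<Longrightarrow> j \<in> I \<Longrightarrow> braket (f i) (f j) = (if i = j then 1 else 0)"
    and "(\<Sum>i\<in>I. outer (f i) (f i)) = mat 1"
  shows "onb I f UNIV"
proof -
  have "v = (\<Sum>i\<in>I. braket (f i) v *s f i)" for v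
  proof -
    have "(\<Sum>i\<in>I. outer (f i) (f i)) *v v = v" by (simp add: assms(3))
    then show ?thesis by (simp add: sum_matrix_vector_mult outer_mult_vec)
  qed
  with assms show ?thesis by (simp add: onb_def)
qed

lemma selfadjoint_eigenvectors_orthogonal:
  assumes "selfadjoint H" "H *v x = complex_of_real a *s x" "H *v y = complex_of_real b *s y"
    and "a \<noteq> b"
  shows "braket x y = 0"
  using braket_selfadjoint[OF assms(1), of x y] assms(2-4) by (simp add: braket_simps)

text \<open>Diagonalising \<open>H\<close> on the whole space gives an eigenbasis \<open>C\<close>
  unrelated to \<open>\<rho>\<close>. Each eigenspace then receives a new basis that diagonalises
  the compression of \<open>\<rho>\<close> to it. Matrix elements of \<open>\<rho>\<close> between
  different eigenspaces remain arbitrary.\<close>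

lemma exists_adapted_eigenbasis:
  fixes H \<rho> :: "complex^'n^'n"
  assumes H: "selfadjoint H" and \<rho>: "selfadjoint \<rho>"
  obtains B e where "onb B id UNIV" "\<And>b. b \<in> B \<Longrightarrow> H *v b = complex_of_real (e b) *s b"
    and "\<And>b c. b \<in> B \<Longrightarrow> c \<in> B \<Longrightarrow> b \<noteq> c \<Longrightarrow> e b = e c \<Longrightarrow> braket b (\<rho> *v c) = 0"
proof -
  define V where "V = (\<lambda>l. {v. H *v v = complex_of_real l *s v})"
  have "vec.subspace (V l)" for l
    by (auto simp: V_def vec.subspace_def matrix_vector_right_distrib matrix_vector_mult_scale
        vec_eq_iff algebra_simps)
  then have "\<exists>B. onb B id (V l) \<and> (\<forall>x\<in>B. \<forall>y\<in>B. x \<noteq> y \<longrightarrow> braket x (\<rho> *v y) = 0)" for l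
    by (rule exists_diagonalising_onb[OF \<rho>]) blast
  then obtain D where D: "\<And>l. onb (D l) id (V l)"
    and diag: "\<And>l x y. x \<in> D l \<Longrightarrow> y \<in> D l \<Longrightarrow> x \<noteq> y \<Longrightarrow> braket x (\<rho> *v y) = 0"
    by metis
  obtain C where C: "onb C id UNIV"
    and Cdiag: "\<And>x y. x \<in> C \<Longrightarrow> y \<in> C \<Longrightarrow> x \<noteq> y \<Longrightarrow> braket x (H *v y) = 0"
    using exists_diagonalising_onb[OF H vec.subspace_UNIV] by blast
  \<comment> \<open>The expectation value equals the eigenvalue at every unit eigenvector, so one
    function gives the energies of both \<open>C\<close> and \<open>B\<close>. Degenerate members of
    \<open>C\<close> contribute the same set \<open>D (e c)\<close> to the union.\<close>
  define e where "e = (\<lambda>x. Re (braket x (H *v x)))"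
  define B where "B = (\<Union>c\<in>C. D (e c))"
  have CV: "c \<in> V (e c)" if "c \<in> C" for c
  proof -
    have "Im (braket c (H *v c)) = 0"
      by (metis H braket_selfadjoint cnj_braket complex_cnj_cancel_iff complex_In_mult_cnj_zero
          Reals_cnj_iff complex_is_Real_iff)
    then have "braket c (H *v c) = complex_of_real (e c)"
      by (simp add: e_def complex_eq_iff)
    moreover have "H *v c = (\<Sum>b\<in>C. braket b (H *v c) *s b)"
      using onbD(4)[OF C, of "H *v c"] by simp
    then have "H *v c = (\<Sum>b\<in>C. if b = c then braket c (H *v c) *s c else 0)"
      using Cdiag[OF _ that] by (smt (verit) sum.cong vector_smult_lzero)
    ultimately show ?thesis
      using that onbD(1)[OF C] by (simp add: V_def)
  qed
  have DV: "D l \<subseteq> V l" for l using onbD(2)[OF D, of _ l] by auto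
  have eD: "e b = l" if "b \<in> D l" for b l
  proof -
    have "H *v b = complex_of_real l *s b" using DV that by (auto simp: V_def)
    then show ?thesis using onbD(3)[OF D that that] by (simp add: e_def braket_simps)
  qed
  have BV: "H *v b = complex_of_real (e b) *s b" if "b \<in> B" for b
  proof -
    from that obtain c where "b \<in> D (e c)" by (auto simp: B_def)
    then show ?thesis using DV[of "e c"] eD[of b "e c"] by (auto simp: V_def)
  qed
  have BD: "b \<in> D (e b)" if "b \<in> B" for b
    using that eD by (auto simp: B_def)
  have orth: "braket (id b) (id c) = (if b = c then 1 else 0)" if "b \<in> B" "c \<in> B" for b c
  proof (cases "e b = e c")
    case True
    then show ?thesis using onbD(3)[OF D, of b "e c" c] BD[of b] BD[of c] that by simp
  next
    case False
    then show ?thesis using selfadjoint_eigenvectors_orthogonal[OF H BV BV False] that by auto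
  qed
  have fin: "finite B" using onbD(1)[OF C] onbD(1)[OF D] by (simp add: B_def)
  \<comment> \<open>Each \<open>c\<close> in \<open>C\<close> is expanded by the basis of its own
    eigenspace and is orthogonal to the rest of \<open>B\<close>, so the candidate resolution of the
    identity fixes every member of \<open>C\<close>.\<close>
  have "onb B id UNIV"
  proof (rule onb_of_resolution[OF fin orth])
    show "(\<Sum>b\<in>B. outer (id b) (id b)) = mat 1"
    proof (rule onb_matrix_eqI[OF C])
      fix c assume c: "c \<in> C"
      have "(\<Sum>b\<in>B. braket b c *s b) = (\<Sum>b\<in>D (e c). braket b c *s b)"
      proof (rule sum.mono_neutral_right[OF fin])
        show "D (e c) \<subseteq> B" using c by (auto simp: B_def)
        show "\<forall>b\<in>B - D (e c). braket b c *s b = 0"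
        proof
          fix b assume b: "b \<in> B - D (e c)"
          then have "e b \<noteq> e c" using BD[of b] by auto
          then have "braket b c = 0"
            using selfadjoint_eigenvectors_orthogonal[OF H BV] CV[OF c] b by (auto simp: V_def)
          then show "braket b c *s b = 0" by simp
        qed
      qed
      also have "\<dots> = c" using onbD(4)[OF D CV[OF c]] by simp
      finally show "(\<Sum>b\<in>B. outer (id b) (id b)) *v id c = mat 1 *v id c"
        by (simp add: sum_matrix_vector_mult outer_mult_vec)
    qed
  qed
  then show ?thesis
    using BV diag BD by (intro that[of B e]) metis+
qed

section \<open>Gibbs states\<close>

lemma scaleR_outer: "c *\<^sub>R outer x y = outer (complex_of_real c *s x) y"
  by (simp add: vec_eq_iff outer_def scaleR_conv_of_real[where 'a = complex])

lemma mpow_eigenvector: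
  assumes "A *v x = c *s x"
  shows "mpow A k *v x = c ^ k *s x"
  by (induction k)
    (simp_all add: assms matrix_vector_mult_scale mult_ac flip: matrix_vector_mul_assoc)

text \<open>Writing the powers of \<open>A\<close> through the projectors of an eigenbasis reduces
  the matrix series to scalar exponential series. The vector \<open>x\<close> need not belong to
  that basis, but its components along basis vectors with an eigenvalue other than \<open>l\<close>
  vanish.\<close>

lemma mexp_eigenvector:
  fixes A :: "complex^'n^'n"
  assumes A: "selfadjoint A" and x: "A *v x = complex_of_real l *s x"
  shows "mexp A *v x = complex_of_real (exp l) *s x"
proof -
  obtain B e where B: "onb B id UNIV" and e: "\<And>b. b \<in> B \<Longrightarrow> A *v b = complex_of_real (e b) *s b"
    using exists_adapted_eigenbasis[OF A A] by metis
  have "mpow A k /\<^sub>R fact k = (\<Sum>b\<in>B. (e b ^ k /\<^sub>R fact k) *\<^sub>R outer b b)" for k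
  proof -
    have "mpow A k = (\<Sum>b\<in>B. e b ^ k *\<^sub>R outer b b)"
    proof (rule onb_matrix_eqI[OF B])
      fix b assume b: "b \<in> B"
      have "(\<Sum>c\<in>B. braket c b *s (complex_of_real (e c) ^ k *s c))
          = (\<Sum>c\<in>B. if c = b then complex_of_real (e b) ^ k *s b else 0)"
        using b onbD(3)[OF B _ b] by (intro sum.cong) auto
      also have "\<dots> = complex_of_real (e b) ^ k *s b"
        using b onbD(1)[OF B] by simp
      finally show "mpow A k *v id b = (\<Sum>b\<in>B. e b ^ k *\<^sub>R outer b b) *v id b"
        by (simp add: mpow_eigenvector[OF e[OF b]] sum_matrix_vector_mult scaleR_outer outer_mult_vec)
    qed
    then show ?thesis by (simp add: scaleR_sum_right)
  qed
  moreover have "(\<lambda>k. \<Sum>b\<in>B. (e b ^ k /\<^sub>R fact k) *\<^sub>R outer b b)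
      sums (\<Sum>b\<in>B. exp (e b) *\<^sub>R outer b b)"
    by (intro sums_sum bounded_linear.sums[OF bounded_linear_scaleR_left] exp_converges)
  ultimately have "mexp A = (\<Sum>b\<in>B. exp (e b) *\<^sub>R outer b b)"
    by (simp add: mexp_def sums_iff)
  then have "mexp A *v x = (\<Sum>b\<in>B. braket b x *s (complex_of_real (exp (e b)) *s b))"
    by (simp add: sum_matrix_vector_mult scaleR_outer outer_mult_vec)
  also have "\<dots> = (\<Sum>b\<in>B. complex_of_real (exp l) *s (braket b x *s b))"
  proof (rule sum.cong)
    fix b assume b: "b \<in> B"
    show "braket b x *s (complex_of_real (exp (e b)) *s b) = complex_of_real (exp l) *s (braket b x *s b)"
    proof (cases "e b = l")
      case False
      then show ?thesis using selfadjoint_eigenvectors_orthogonal[OF A e[OF b] x] by simp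
    qed (simp add: mult_ac)
  qed simp
  also have "\<dots> = complex_of_real (exp l) *s (\<Sum>b\<in>B. braket b x *s b)"
    by (simp add: vec.scale_sum_right)
  also have "(\<Sum>b\<in>B. braket b x *s b) = x" using onbD(4)[OF B, of x] by simp
  finally show ?thesis .
qed

text \<open>\<open>Z\<close> is the partition function. It suffices that it is nonzero and common to
  all eigenvectors, because later only the equality of eigenvalues is tested.\<close>

lemma gibbs_eigenvector:
  assumes "hamiltonian_of \<beta> \<gamma> H" "trace \<gamma> = 1"
  obtains Z where "Z \<noteq> 0"
    "\<And>x e. H *v x = complex_of_real e *s x \<Longrightarrow> \<gamma> *v x = (complex_of_real (exp (- \<beta> * e)) / Z) *s x"
proof -
  define M where "M = mexp ((- \<beta>) *\<^sub>R H)"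
  have H: "selfadjoint H" and \<gamma>: "\<gamma> = (\<chi> i j. M $ i $ j / trace M)"
    using assms(1) by (simp_all add: hamiltonian_of_def M_def)
  \<comment> \<open>Division by zero yields zero, so a vanishing trace of \<open>M\<close> would
    make \<open>\<gamma>\<close> zero, against its trace being 1.\<close>
  have "trace M \<noteq> 0" using assms(2) by (auto simp: \<gamma> trace_def)
  moreover have "\<gamma> *v x = (complex_of_real (exp (- \<beta> * e)) / trace M) *s x"
    if "H *v x = complex_of_real e *s x" for x e
  proof -
    have "selfadjoint ((- \<beta>) *\<^sub>R H)"
      using H by (simp add: selfadjoint_def hconj_def vec_eq_iff)
    moreover have "((- \<beta>) *\<^sub>R H) *v x = complex_of_real (- \<beta>) *s (H *v x)"
      by (simp add: vec_eq_iff matrix_vector_mult_def sum_distrib_left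
          scaleR_conv_of_real[where 'a = complex] mult_ac sum_negf)
    then have "((- \<beta>) *\<^sub>R H) *v x = complex_of_real (- \<beta> * e) *s x"
      by (simp add: that)
    ultimately have "M *v x = complex_of_real (exp (- \<beta> * e)) *s x"
      unfolding M_def by (rule mexp_eigenvector)
    moreover have "\<gamma> *v x = (1 / trace M) *s (M *v x)"
      by (simp add: \<gamma> vec_eq_iff matrix_vector_mult_def sum_divide_distrib)
    ultimately show ?thesis by simp
  qed
  ultimately show ?thesis by (rule that)
qed

section \<open>Strict positivity of states of full rank\<close>

lemma full_rank_kernel:
  fixes A :: "complex^'n^'n"
  assumes "full_rank A" "A *v x = 0"
  shows "x = 0"
proof -
  have "vec.dim (rows A) = vec.dim (UNIV :: (complex^'n) set)"
    using assms(1) by (simp add: full_rank_def row_rank_def_gen vec.dim_UNIV card_cart_basis)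
  then have "vec.span (rows A) = UNIV"
    using vec.dim_eq_full vec.dimension_def vec.dim_UNIV by metis
  then show ?thesis
    using assms(2) matrix_left_invertible_span_rows_gen matrix_left_invertible_ker by blast
qed

text \<open>At a zero \<open>x\<close> of the nonnegative form, the form of \<open>- \<rho>\<close>
  is maximal with \<open>m = 0\<close>. Stationarity in the direction \<open>\<rho> *v x\<close>
  then gives \<open>\<rho> *v x = 0\<close>, which full rank excludes for nonzero
  \<open>x\<close>.\<close>

lemma full_rank_density_matrix_pos:
  fixes \<rho> :: "complex^'n^'n"
  assumes "density_matrix \<rho>" "full_rank \<rho>" "x \<noteq> 0"
  shows "Re (braket x (\<rho> *v x)) > 0"
proof (rule ccontr)
  assume "\<not> ?thesis"
  moreover have psd: "0 \<le> Re (braket y (\<rho> *v y))" for y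
    using assms(1) by (simp add: density_matrix_def)
  ultimately have x: "Re (braket x (\<rho> *v x)) = 0" by (metis antisym_conv linorder_not_le order.order_iff_strict)
  have neg: "(- \<rho>) *v y = - (\<rho> *v y)" "braket z (- y) = - braket z y" for y z
    by (simp_all add: vec_eq_iff matrix_vector_mult_def braket_def sum_negf)
  have "selfadjoint (- \<rho>)"
    using assms(1) by (simp add: density_matrix_def selfadjoint_def hconj_def vec_eq_iff)
  then have "braket (\<rho> *v x) ((- \<rho>) *v x) = of_real 0 * braket (\<rho> *v x) x"
    by (rule maximiser_stationary[where V = UNIV]) (simp_all add: psd x neg)
  then have "\<rho> *v x = 0" by (simp add: neg braket_self)
  then show False using full_rank_kernel[OF assms(2)] assms(3) by blast
qed

section \<open>Tensor products\<close>

definition tens :: "complex^'n \<Rightarrow> complex^'m \<Rightarrow> complex^('n \<times> 'm)" where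
  "tens x y = (\<chi> p. x $ fst p * y $ snd p)"

lemma sum_UNIV_prod: "(\<Sum>p\<in>UNIV. h p) = (\<Sum>i\<in>UNIV. \<Sum>j\<in>UNIV. h (i, j))"
  by (simp add: sum.cartesian_product)

lemma braket_tens: "braket (tens x y) (tens z w) = braket x z * braket y w"
  by (simp add: braket_def tens_def sum_UNIV_prod sum_product mult_ac)

lemma tens_scale: "tens (c *s x) (d *s y) = (c * d) *s tens x y"
  by (simp add: tens_def vec_eq_iff mult_ac)

lemma tensor_mult_tens: "(A \<otimes>\<^sub>m B) *v tens x y = tens (A *v x) (B *v y)"
  by (simp add: tens_def tensor_def vec_eq_iff matrix_vector_mult_def sum_UNIV_prod sum_product mult_ac)

lemma trace_tensor: "trace (A \<otimes>\<^sub>m B) = trace A * trace B"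
  by (simp add: trace_def tensor_def sum_UNIV_prod sum_product)

lemma tensor_mult: "(A \<otimes>\<^sub>m B) ** (C \<otimes>\<^sub>m D) = (A ** C) \<otimes>\<^sub>m (B ** D)"
  by (simp add: tensor_def vec_eq_iff matrix_matrix_mult_def sum_UNIV_prod sum_product mult_ac)

lemma hconj_tensor: "hconj (A \<otimes>\<^sub>m B) = hconj A \<otimes>\<^sub>m hconj B"
  by (simp add: hconj_def tensor_def vec_eq_iff)

lemma onb_tens:
  fixes f :: "'i \<Rightarrow> complex^'n" and g :: "'j \<Rightarrow> complex^'m"
  assumes f: "onb I f UNIV" and g: "onb J g UNIV"
  shows "onb (I \<times> J) (\<lambda>(i, j). tens (f i) (g j)) UNIV"
proof (rule onb_of_resolution)
  show "finite (I \<times> J)" using onbD(1)[OF f] onbD(1)[OF g] by simp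
  show "braket (case a of (i, j) \<Rightarrow> tens (f i) (g j)) (case b of (i, j) \<Rightarrow> tens (f i) (g j))
      = (if a = b then 1 else 0)" if "a \<in> I \<times> J" "b \<in> I \<times> J" for a b
    using that onbD(3)[OF f] onbD(3)[OF g] by (auto simp: braket_tens split: if_splits)
  have "(\<Sum>a\<in>I \<times> J. outer (case a of (i, j) \<Rightarrow> tens (f i) (g j)) (case a of (i, j) \<Rightarrow> tens (f i) (g j)))
      = (\<Sum>i\<in>I. outer (f i) (f i)) \<otimes>\<^sub>m (\<Sum>j\<in>J. outer (g j) (g j))"
    by (simp add: vec_eq_iff tensor_def outer_def tens_def sum_product sum.cartesian_product mult_ac
        split_beta)
  also have "\<dots> = mat 1"
    unfolding onb_resolution[OF f] onb_resolution[OF g]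
    by (auto simp: tensor_def mat_def vec_eq_iff prod_eq_iff)
  finally show "(\<Sum>a\<in>I \<times> J. outer (case a of (i, j) \<Rightarrow> tens (f i) (g j))
      (case a of (i, j) \<Rightarrow> tens (f i) (g j))) = mat 1" .
qed

lemma braket_axis: "braket (axis i 1) x = x $ i"
proof -
  have "braket (axis i 1) x = (\<Sum>j\<in>UNIV. if j = i then x $ i else 0)"
    unfolding braket_def by (rule sum.cong) (auto simp: axis_def)
  then show ?thesis by simp
qed

lemma onb_axis: "onb UNIV (\<lambda>i. axis i 1) (UNIV :: (complex^'n) set)"
  unfolding onb_def
  by (simp add: braket_axis basis_expansion) (simp add: axis_def)

lemma diag2_mult_axis: "diag2 a b *v axis q 1 = (if q = 1 then a else b) *s axis q 1"
  using exhaust_2[of q]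
  by (auto simp: vec_eq_iff forall_2 diag2_def matrix_vector_mult_def sum_2 axis_def)

section \<open>Passivity and cooling\<close>

lemma qubit_gibbs_mult_axis:
  "qubit_gibbs \<beta> E *v axis q 1
     = complex_of_real ((if q = 1 then 1 else exp (- \<beta> * E)) / (1 + exp (- \<beta> * E))) *s axis q 1"
proof -
  have "(c *\<^sub>R A) *v x = complex_of_real c *s (A *v x)" for c and A :: "complex^2^2" and x
    by (simp add: vec_eq_iff matrix_vector_mult_def sum_distrib_left
        scaleR_conv_of_real[where 'a = complex] mult_ac)
  then show ?thesis
    by (simp add: qubit_gibbs_def diag2_mult_axis)
qed

lemma selfadjoint_diag2: "selfadjoint (diag2 (complex_of_real a) (complex_of_real b))"
  by (simp add: selfadjoint_def hconj_def diag2_def vec_eq_iff forall_2)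

lemma selfadjoint_qubit_gibbs: "selfadjoint (qubit_gibbs \<beta> E)"
  using selfadjoint_diag2[of 1 "exp (- \<beta> * E)"]
  by (simp add: selfadjoint_def qubit_gibbs_def hconj_def vec_eq_iff)

lemma selfadjoint_sigma_z: "selfadjoint sigma_z"
  using selfadjoint_diag2[of 1 "- 1"] by (simp add: sigma_z_def)

lemma selfadjoint_tensor: "selfadjoint A \<Longrightarrow> selfadjoint B \<Longrightarrow> selfadjoint (A \<otimes>\<^sub>m B)"
  by (simp add: selfadjoint_def hconj_tensor)

lemma selfadjoint_mat_1: "selfadjoint (mat 1)"
  by (auto simp: selfadjoint_def hconj_def mat_def vec_eq_iff)

lemma selfadjoint_braket_real:
  assumes "selfadjoint A"
  shows "braket x (A *v x) = complex_of_real (Re (braket x (A *v x)))"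
proof -
  have "cnj (braket x (A *v x)) = braket x (A *v x)"
    by (simp add: cnj_braket braket_selfadjoint[OF assms])
  then show ?thesis by (simp add: complex_eq_iff)
qed

lemma selfadjoint_eigenvalue_real:
  assumes "selfadjoint A" "A *v x = c *s x" "braket x x = 1"
  shows "cnj c = c"
  using braket_selfadjoint[OF assms(1), of x x] assms(2,3) by (simp add: braket_simps)

text \<open>Column sums allow subtracting the threshold \<open>c\<close>, which depends only on the energy \<open>t\<close> and
  separates the populations \<open>r\<close> with sign \<open>1\<close> from those with sign \<open>- 1\<close>; what remains is
  nonnegative term by term.\<close>
lemma doubly_stochastic_passive:
  fixes D :: "'i \<Rightarrow> 'i \<Rightarrow> real" and r s t :: "'i \<Rightarrow> real"
  assumes I: "finite I" and D: "\<And>a b. 0 \<le> D a b"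
    and row: "\<And>a. a \<in> I \<Longrightarrow> (\<Sum>b\<in>I. D a b) = 1"
    and col: "\<And>b. b \<in> I \<Longrightarrow> (\<Sum>a\<in>I. D a b) = 1"
    and supp: "\<And>a b. a \<in> I \<Longrightarrow> b \<in> I \<Longrightarrow> t a \<noteq> t b \<Longrightarrow> D a b = 0"
    and s: "\<And>a. a \<in> I \<Longrightarrow> s a = 1 \<or> s a = - 1"
    and r: "\<And>a. a \<in> I \<Longrightarrow> 0 \<le> r a"
    and no_inversion: "\<And>a b. a \<in> I \<Longrightarrow> b \<in> I \<Longrightarrow> t a = t b \<Longrightarrow> s a = 1 \<Longrightarrow> s b = - 1 \<Longrightarrow> r b \<le> r a"
  shows "(\<Sum>a\<in>I. s a * (\<Sum>b\<in>I. D a b * r b)) \<le> (\<Sum>b\<in>I. s b * r b)"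
proof -
  \<comment> \<open>The threshold is the largest population with sign \<open>- 1\<close> at the
    given energy. Inserting 0 keeps the maximum meaningful on levels without such populations; the
    upper estimate survives because populations are nonnegative.\<close>
  define M where "M = (\<lambda>\<tau>. insert 0 (r ` {b \<in> I. s b = - 1 \<and> t b = \<tau>}))"
  define c where "c = (\<lambda>\<tau>. Max (M \<tau>))"
  have fin: "finite (M \<tau>)" for \<tau> using I by (simp add: M_def)
  have lower: "r b \<le> c (t b)" if "b \<in> I" "s b = - 1" for b
    unfolding c_def by (rule Max_ge[OF fin]) (use that in \<open>auto simp: M_def\<close>)
  have upper: "c (t b) \<le> r b" if "b \<in> I" "s b = 1" for b
  proof -
    have "M (t b) \<noteq> {}" by (simp add: M_def)
    then show ?thesis
      unfolding c_def using that r no_inversion by (subst Max_le_iff[OF fin]) (auto simp: M_def)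
  qed
  \<comment> \<open>This is needed both for \<open>r\<close> and for the threshold. For the
    threshold, constant on energy levels, row sums and the support of \<open>D\<close> make the left
    side vanish, so it can be subtracted from \<open>r\<close>.\<close>
  have swap: "(\<Sum>b\<in>I. s b * h b) - (\<Sum>a\<in>I. s a * (\<Sum>b\<in>I. D a b * h b))
      = (\<Sum>a\<in>I. \<Sum>b\<in>I. D a b * (s b - s a) * h b)" for h
  proof -
    have "(\<Sum>b\<in>I. s b * h b) = (\<Sum>b\<in>I. (\<Sum>a\<in>I. D a b) * (s b * h b))"
      by (rule sum.cong) (simp_all add: col)
    also have "\<dots> = (\<Sum>a\<in>I. \<Sum>b\<in>I. D a b * (s b * h b))"
      unfolding sum_distrib_right by (rule sum.swap)
    finally show ?thesis
      by (simp add: sum_distrib_left algebra_simps flip: sum_subtractf)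
  qed
  have "(\<Sum>a\<in>I. s a * (\<Sum>b\<in>I. D a b * c (t b))) = (\<Sum>a\<in>I. s a * c (t a))"
  proof (rule sum.cong)
    fix a assume a: "a \<in> I"
    have "(\<Sum>b\<in>I. D a b * c (t b)) = (\<Sum>b\<in>I. D a b * c (t a))"
      using supp[OF a] by (intro sum.cong) (auto, metis)
    also have "\<dots> = c (t a)" using row[OF a] by (simp flip: sum_distrib_right)
    finally show "s a * (\<Sum>b\<in>I. D a b * c (t b)) = s a * c (t a)" by simp
  qed simp
  then have "0 = (\<Sum>a\<in>I. \<Sum>b\<in>I. D a b * (s b - s a) * c (t b))"
    using swap[of "\<lambda>b. c (t b)"] by simp
  then have "(\<Sum>b\<in>I. s b * r b) - (\<Sum>a\<in>I. s a * (\<Sum>b\<in>I. D a b * r b))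
      = (\<Sum>a\<in>I. \<Sum>b\<in>I. D a b * (s b - s a) * (r b - c (t b)))"
    unfolding swap by (simp add: right_diff_distrib sum_subtractf)
  also have "\<dots> \<ge> 0"
  proof (intro sum_nonneg)
    \<comment> \<open>Only transitions that change the sign contribute. Then
      \<open>s b - s a\<close> has the sign of \<open>s b\<close>, and the threshold gives the other
      factor the same sign or zero.\<close>
    fix a b assume "a \<in> I" "b \<in> I"
    then have "0 \<le> (s b - s a) * (r b - c (t b))"
      using s[of a] s[of b] lower[of b] upper[of b] by auto
    then show "0 \<le> D a b * (s b - s a) * (r b - c (t b))"
      using D[of a b] by (simp add: mult.assoc)
  qed
  finally show ?thesis by simp
qed

text \<open>The squared moduli of the matrix elements of \<open>u\<close> form a doubly stochastic
  matrix that connects only equal labels \<open>t\<close>. Off-diagonal elements of \<open>R\<close>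
  between different labels do not reach the diagonal of \<open>u ** R ** hconj u\<close>, and those
  within one label vanish by assumption. So only the populations \<open>r\<close> matter, and
  \<open>doubly_stochastic_passive\<close> applies.\<close>

lemma energy_conserving_trace_le:
  fixes u R S :: "complex^'n^'n" and r s t :: "'i \<Rightarrow> real"
  assumes f: "onb I f UNIV" and u: "unitary u"
    and conserve: "\<And>a b. a \<in> I \<Longrightarrow> b \<in> I \<Longrightarrow> t a \<noteq> t b \<Longrightarrow> braket (f a) (u *v f b) = 0"
    and R: "\<And>b c. b \<in> I \<Longrightarrow> c \<in> I \<Longrightarrow> t b = t c \<Longrightarrow>
      braket (f b) (R *v f c) = (if b = c then complex_of_real (r b) else 0)"
    and S: "\<And>a. a \<in> I \<Longrightarrow> S *v f a = complex_of_real (s a) *s f a"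
    and s: "\<And>a. a \<in> I \<Longrightarrow> s a = 1 \<or> s a = - 1"
    and r: "\<And>a. a \<in> I \<Longrightarrow> 0 \<le> r a"
    and no_inversion: "\<And>a b. a \<in> I \<Longrightarrow> b \<in> I \<Longrightarrow> t a = t b \<Longrightarrow> s a = 1 \<Longrightarrow> s b = - 1 \<Longrightarrow> r b \<le> r a"
  shows "Re (trace (u ** R ** hconj u ** S)) \<le> (\<Sum>a\<in>I. s a * r a)"
proof -
  define U where "U = (\<lambda>a b. braket (f a) (u *v f b))"
  define D where "D = (\<lambda>a b. (cmod (U a b))\<^sup>2)"
  have I: "finite I" using onbD(1)[OF f] .
  have UU: "U a b * cnj (U a b) = complex_of_real (D a b)" for a b
    by (simp add: D_def complex_norm_square del: of_real_power)
  have U1: "braket (hconj u *v f a) (f b) = U a b" for a b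
    by (simp add: U_def braket_hconj)
  have U2: "braket (f b) (hconj u *v f a) = cnj (U a b)" for a b
    using U1 cnj_braket by metis
  have unit: "braket (f a) (f a) = 1" if "a \<in> I" for a using onbD(3)[OF f that that] by simp
  have row: "(\<Sum>b\<in>I. D a b) = 1" if "a \<in> I" for a
  proof -
    have "complex_of_real (\<Sum>b\<in>I. D a b) = braket (hconj u *v f a) (hconj u *v f a)"
      by (subst onb_parseval[OF f]) (simp add: U1 U2 UU)
    also have "\<dots> = braket (f a) ((u ** hconj u) *v f a)"
      by (simp add: braket_hconj flip: matrix_vector_mul_assoc)
    finally show ?thesis using u unit[OF that] by (simp add: unitary_def flip: of_real_eq_1_iff[where 'a = complex])
  qed
  have col: "(\<Sum>a\<in>I. D a b) = 1" if "b \<in> I" for b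
  proof -
    have "complex_of_real (\<Sum>a\<in>I. D a b) = braket (u *v f b) (u *v f b)"
      by (subst onb_parseval[OF f])
        (simp add: U_def cnj_braket[of "f _" "u *v f b", symmetric] mult.commute flip: UU)
    also have "\<dots> = braket ((hconj u ** u) *v f b) (f b)"
      by (simp add: braket_hconj[of _ u] flip: matrix_vector_mul_assoc)
    finally show ?thesis using u unit[OF that] by (simp add: unitary_def flip: of_real_eq_1_iff[where 'a = complex])
  qed
  have diag: "braket (hconj u *v f a) (R *v (hconj u *v f a)) = complex_of_real (\<Sum>b\<in>I. D a b * r b)"
    if a: "a \<in> I" for a
  proof -
    let ?w = "hconj u *v f a"
    have "braket ?w (R *v ?w) = (\<Sum>b\<in>I. U a b * braket (f b) (R *v ?w))"
      by (subst onb_parseval[OF f]) (simp add: U1)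
    also have "\<dots> = (\<Sum>b\<in>I. complex_of_real (D a b * r b))"
    proof (rule sum.cong)
      fix b assume b: "b \<in> I"
      have "R *v ?w = R *v (\<Sum>c\<in>I. braket (f c) ?w *s f c)"
        by (simp add: onbD(4)[OF f])
      then have "U a b * braket (f b) (R *v ?w) = (\<Sum>c\<in>I. U a b * (cnj (U a c) * braket (f b) (R *v f c)))"
        by (simp add: matrix_vector_mult_sum matrix_vector_mult_scale braket_sum_right braket_simps
            U2 sum_distrib_left)
      also have "\<dots> = (\<Sum>c\<in>I. if c = b then complex_of_real (D a b * r b) else 0)"
      proof (rule sum.cong)
        fix c assume c: "c \<in> I"
        show "U a b * (cnj (U a c) * braket (f b) (R *v f c))
            = (if c = b then complex_of_real (D a b * r b) else 0)"
        \<comment> \<open>If both transitions preserve the label, then \<open>b\<close> and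
          \<open>c\<close> share it and \<open>R\<close> is diagonal there; otherwise one of the two
          matrix elements of \<open>u\<close> is zero.\<close>
        proof (cases "t a = t b \<and> t a = t c")
          case True
          then show ?thesis using R[OF b c] by (simp flip: UU)
        next
          case False
          then have "U a b = 0 \<or> U a c = 0" using conserve[OF a b] conserve[OF a c] unfolding U_def by blast
          then show ?thesis by (auto simp: D_def)
        qed
      qed simp
      also have "\<dots> = complex_of_real (D a b * r b)" using b I by simp
      finally show "U a b * braket (f b) (R *v ?w) = complex_of_real (D a b * r b)" .
    qed simp
    finally show ?thesis by simp
  qed
  have "trace (u ** R ** hconj u ** S) = (\<Sum>a\<in>I. complex_of_real (s a * (\<Sum>b\<in>I. D a b * r b)))"
    unfolding onb_trace[OF f]
  proof (rule sum.cong)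
    fix a assume a: "a \<in> I"
    show "braket (f a) (u ** R ** hconj u ** S *v f a) = complex_of_real (s a * (\<Sum>b\<in>I. D a b * r b))"
      using diag[OF a] unfolding braket_hconj[of "f a" u, symmetric]
      by (simp add: S[OF a] matrix_vector_mult_scale braket_simps braket_hconj[of "f a" u]
          flip: matrix_vector_mul_assoc)
  qed simp
  then have "Re (trace (u ** R ** hconj u ** S)) = (\<Sum>a\<in>I. s a * (\<Sum>b\<in>I. D a b * r b))"
    by simp
  also have "\<dots> \<le> (\<Sum>a\<in>I. s a * r a)"
  proof (rule doubly_stochastic_passive[OF I _ row col _ s r no_inversion])
    show "D a b = 0" if "a \<in> I" "b \<in> I" "t a \<noteq> t b" for a b
      using conserve[OF that] by (simp add: D_def U_def)
  qed (simp_all add: D_def)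
  finally show ?thesis .
qed

section \<open>The unitary exchanging two degenerate vectors\<close>

lemma matrix_sub_ldistrib: "A ** (B - C) = A ** B - A ** C"
  for A :: "complex^'n^'m"
  by (simp add: vec_eq_iff matrix_matrix_mult_def sum_subtractf algebra_simps)

text \<open>The witness is the reflection \<open>1 - |d\<rangle>\<langle>d|\<close> with \<open>d = x - y\<close>, \<open>\<langle>d|d\<rangle> = 2\<close>, which
  exchanges \<open>x\<close> and \<open>y\<close>.\<close>
lemma exists_swap_unitary:
  fixes G R S :: "complex^'n^'n"
  assumes xy: "braket x x = 1" "braket y y = 1" "braket x y = 0"
    and G: "selfadjoint G" "G *v x = g *s x" "G *v y = g *s y"
    and S: "selfadjoint S" "S *v x = x" "S *v y = - y"
  obtains u where "unitary u" "u ** G = G ** u"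
    and "trace (u ** R ** hconj u ** S)
      = trace (R ** S) - 2 * braket x (R *v x) + 2 * braket y (R *v y)"
proof -
  define d where "d = x - y"
  define u where "u = mat 1 - outer d d"
  have yx: "braket y x = 0" using cnj_braket[of x y] xy by simp
  have u: "u *v v = v - braket d v *s d" for v
    by (simp add: u_def matrix_vector_mult_diff_rdistrib outer_mult_vec)
  have hu: "hconj u = u"
    by (auto simp: u_def hconj_def outer_def vec_eq_iff mat_def mult.commute)
  have dd: "braket d d = 2" by (simp add: d_def braket_simps xy yx)
  have "u ** u = mat 1"
    by (simp add: matrix_eq u dd braket_simps flip: matrix_vector_mul_assoc)
  then have "unitary u" by (simp add: unitary_def hu)
  moreover have "u ** G = G ** u"
  proof -
    \<comment> \<open>By degeneracy \<open>d\<close> is an eigenvector of \<open>G\<close>, and its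
      eigenvalue is real; therefore \<open>G\<close> commutes with |d><d|.\<close>
    have "G *v d = g *s d"
      by (simp add: d_def matrix_vector_mult_diff_distrib G vec_eq_iff algebra_simps)
    moreover have "braket d (G *v v) = g * braket d v" for v
      using selfadjoint_eigenvalue_real[OF G(1,2) xy(1)]
      by (simp add: braket_selfadjoint[OF G(1)] \<open>G *v d = g *s d\<close> braket_simps)
    ultimately show ?thesis
      by (simp add: matrix_eq u matrix_vector_mult_diff_distrib matrix_vector_mult_scale mult_ac
          flip: matrix_vector_mul_assoc)
  qed
  moreover have "trace (u ** R ** hconj u ** S)
      = trace (R ** S) - 2 * braket x (R *v x) + 2 * braket y (R *v y)"
  proof -
    have Sd: "S *v d = x + y"
      by (simp add: d_def matrix_vector_mult_diff_distrib S)
    have dS: "braket d (S *v v) = braket x v + braket y v" for v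
      by (simp add: braket_selfadjoint[OF S(1)] Sd braket_simps)
    \<comment> \<open>Cyclicity of the trace will move the conjugation onto \<open>S\<close>, where
      it only exchanges the signs of \<open>x\<close> and \<open>y\<close>. The repeated summands
      stand for a factor 2.\<close>
    have "u ** S ** u = S + (outer y y + outer y y) - (outer x x + outer x x)"
      unfolding matrix_eq
    proof
      fix v
      have "braket d x = 1" "braket d y = - 1" by (simp_all add: d_def braket_simps xy yx)
      then have "u *v (S *v (u *v v)) = S *v v - braket d v *s (x + y) - (braket x v + braket y v) *s d"
        by (simp add: u matrix_vector_mult_diff_distrib matrix_vector_mult_scale dS Sd
            braket_simps(2-6))
      then show "(u ** S ** u) *v v = (S + (outer y y + outer y y) - (outer x x + outer x x)) *v v"
        unfolding matrix_vector_mult_add_rdistrib matrix_vector_mult_diff_rdistrib outer_mult_vec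
        by (simp flip: matrix_vector_mul_assoc)
          (simp add: d_def vec_eq_iff braket_simps algebra_simps)
    qed
    have "trace (u ** R ** hconj u ** S) = trace (R ** (u ** S ** u))"
      using trace_mul_sym[of u "R ** u ** S"] by (simp add: hu matrix_mul_assoc)
    also have "u ** S ** u = S + (outer y y + outer y y) - (outer x x + outer x x)" by fact
    also have "trace (R ** \<dots>) = trace (R ** S) - 2 * braket x (R *v x) + 2 * braket y (R *v y)"
      unfolding matrix_sub_ldistrib matrix_add_ldistrib trace_add trace_sub mult_outer trace_outer
      by simp
    finally show ?thesis .
  qed
  ultimately show ?thesis by (rule that)
qed

text \<open>The denominator \<open>ey - ex = - E\<close> is negative, so multiplying it out reverses
  the inequality. The factor \<open>exp (- \<beta> * E)\<close> is the population ratio of the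
  qubit; the right side thus compares the populations of two degenerate product vectors.\<close>

lemma rel_inv_temp_gt_iff:
  assumes "Re (braket x (\<rho> *v x)) > 0" "Re (braket y (\<rho> *v y)) > 0" "ex - ey = E" "E > 0"
  shows "rel_inv_temp \<rho> x ex y ey > \<beta> \<longleftrightarrow>
    Re (braket x (\<rho> *v x)) < Re (braket y (\<rho> *v y)) * exp (- \<beta> * E)"
proof -
  define p q where "p = Re (braket x (\<rho> *v x))" and "q = Re (braket y (\<rho> *v y))"
  have pq: "p > 0" "q > 0" using assms by (simp_all add: p_def q_def)
  have "ey - ex = - E" using assms(3) by simp
  then have "rel_inv_temp \<rho> x ex y ey > \<beta> \<longleftrightarrow> ln p < ln q + - \<beta> * E"
    using assms(4)
    unfolding rel_inv_temp_def \<open>ey - ex = - E\<close> p_def[symmetric] q_def[symmetric]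
    by (simp add: field_simps)
  also have "ln q + - \<beta> * E = ln (q * exp (- \<beta> * E))"
    using pq by (simp add: ln_mult)
  also have "ln p < \<dots> \<longleftrightarrow> p < q * exp (- \<beta> * E)"
    using pq by simp
  finally show ?thesis by (simp add: p_def q_def)
qed

theorem theorem1:
  fixes \<beta> E :: real and \<rho> \<gamma> H :: "complex^'n^'n"
  assumes "\<beta> \<noteq> 0"
    and "object \<rho> \<gamma>" and "full_rank \<rho>"
    and "hamiltonian_of \<beta> \<gamma> H"
    and "E > 0"
  shows "can_cool \<rho> \<gamma> (qubit_gibbs \<beta> E) \<longleftrightarrow>
    (\<exists>x ei y ej. unit_eigenvector H ei x \<and> unit_eigenvector H ej y \<and> ei \<noteq> ej \<and> ei - ej = E \<and>
       rel_inv_temp \<rho> x ei y ej > \<beta>)"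
proof -
  define \<sigma> where "\<sigma> = qubit_gibbs \<beta> E"
  define w where "w = (\<lambda>q :: 2. (if q = 1 then 1 else exp (- \<beta> * E)) / (1 + exp (- \<beta> * E)))"
  define p where "p = (\<lambda>x. Re (braket x (\<rho> *v x)))"
  define z where "z = (\<lambda>q :: 2. if q = 1 then 1 else - 1 :: real)"
  have \<rho>: "density_matrix \<rho>" and \<gamma>: "density_matrix \<gamma>"
    using assms(2) by (simp_all add: object_def)
  then have sa: "selfadjoint \<rho>" "selfadjoint \<gamma>" "trace \<rho> = 1" "trace \<gamma> = 1"
    by (simp_all add: density_matrix_def)
  have H: "selfadjoint H" using assms(4) by (simp add: hamiltonian_of_def)
  obtain Z where "Z \<noteq> 0" and Z: "\<And>x e. H *v x = complex_of_real e *s x \<Longrightarrow>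
      \<gamma> *v x = (complex_of_real (exp (- \<beta> * e)) / Z) *s x"
    using gibbs_eigenvector[OF assms(4) sa(4)] by metis
  have den: "1 + exp (- \<beta> * E) > 0" by (simp add: add_pos_pos)
  have w_pos: "w q > 0" for q using den by (simp add: w_def)
  have w2: "w 2 = exp (- \<beta> * E) * w 1" by (simp add: w_def)
  have \<sigma>_axis: "\<sigma> *v axis q 1 = complex_of_real (w q) *s axis q 1" for q
    unfolding \<sigma>_def w_def by (rule qubit_gibbs_mult_axis)
  have z_axis: "sigma_z *v axis q 1 = complex_of_real (z q) *s axis q 1" for q
    by (simp add: sigma_z_def diag2_mult_axis z_def)
  have G: "selfadjoint (\<gamma> \<otimes>\<^sub>m \<sigma>)"
    using sa(2) selfadjoint_qubit_gibbs by (simp add: selfadjoint_tensor \<sigma>_def)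
  \<comment> \<open>The eigenvalue depends on the product vector only through its total energy, to
    which the qubit adds 0 or \<open>E\<close>.\<close>
  have G_tens: "(\<gamma> \<otimes>\<^sub>m \<sigma>) *v tens x (axis q 1)
      = (complex_of_real (exp (- \<beta> * (e + (if q = 1 then 0 else E))) / (1 + exp (- \<beta> * E))) / Z)
          *s tens x (axis q 1)"
    if "H *v x = complex_of_real e *s x" for x e q
  proof -
    have "exp (- \<beta> * (e + (if q = 1 then 0 else E)))
        = exp (- \<beta> * e) * (if q = 1 then 1 else exp (- \<beta> * E))"
      by (simp add: distrib_left exp_diff exp_minus field_simps)
    then show ?thesis
      by (simp only: tensor_mult_tens Z[OF that] \<sigma>_axis tens_scale) (simp add: w_def)
  qed
  have p_pos: "p x > 0" if "norm x = 1" for x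
    unfolding p_def using that by (intro full_rank_density_matrix_pos[OF \<rho> assms(3)]) auto
  have \<rho>_diag: "braket x (\<rho> *v x) = complex_of_real (p x)" for x
    unfolding p_def by (rule selfadjoint_braket_real[OF sa(1)])
  have axis_orth: "braket (axis q 1) (axis q' 1) = (if q = q' then 1 else 0)" for q q' :: 2
    using onbD(3)[OF onb_axis, of q q'] by simp
  have tr_\<sigma>: "trace (\<sigma> ** sigma_z) = complex_of_real (w 1 - w 2)"
    by (simp add: onb_trace[OF onb_axis] sum_2 z_axis \<sigma>_axis matrix_vector_mult_scale
        braket_simps axis_orth z_def flip: matrix_vector_mul_assoc)
  have temp: "rel_inv_temp \<rho> x ei y ej > \<beta> \<longleftrightarrow> p x < p y * exp (- \<beta> * E)"
    if "norm x = 1" "norm y = 1" "ei - ej = E" for x ei y ej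
    using rel_inv_temp_gt_iff[OF _ _ that(3) assms(5)] p_pos[OF that(1)] p_pos[OF that(2)]
    by (simp add: p_def)
  show ?thesis
  proof
    assume "\<exists>x ei y ej. unit_eigenvector H ei x \<and> unit_eigenvector H ej y \<and> ei \<noteq> ej \<and> ei - ej = E \<and>
       rel_inv_temp \<rho> x ei y ej > \<beta>"
    then obtain x ei y ej where x: "norm x = 1" "H *v x = complex_of_real ei *s x"
      and y: "norm y = 1" "H *v y = complex_of_real ej *s y"
      and E: "ei - ej = E" and "rel_inv_temp \<rho> x ei y ej > \<beta>"
      by (auto simp: unit_eigenvector_def)
    then have less: "p x < p y * exp (- \<beta> * E)" by (simp add: temp)
    let ?X = "tens x (axis 1 1 :: complex^2)" and ?Y = "tens y (axis 2 1 :: complex^2)"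
    obtain u where u: "unitary u" "u ** (\<gamma> \<otimes>\<^sub>m \<sigma>) = (\<gamma> \<otimes>\<^sub>m \<sigma>) ** u"
      and tr: "trace (u ** (\<rho> \<otimes>\<^sub>m \<sigma>) ** hconj u ** (mat 1 \<otimes>\<^sub>m sigma_z))
        = trace ((\<rho> \<otimes>\<^sub>m \<sigma>) ** (mat 1 \<otimes>\<^sub>m sigma_z))
          - 2 * braket ?X ((\<rho> \<otimes>\<^sub>m \<sigma>) *v ?X) + 2 * braket ?Y ((\<rho> \<otimes>\<^sub>m \<sigma>) *v ?Y)"
    proof (rule exists_swap_unitary)
      show "braket ?X ?X = 1" "braket ?Y ?Y = 1" "braket ?X ?Y = 0"
        using x(1) y(1) by (simp_all add: braket_tens axis_orth norm_one_iff_braket)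
      show "selfadjoint (\<gamma> \<otimes>\<^sub>m \<sigma>)" by (fact G)
      show "(\<gamma> \<otimes>\<^sub>m \<sigma>) *v ?X = (complex_of_real (exp (- \<beta> * ei) / (1 + exp (- \<beta> * E))) / Z) *s ?X"
        using G_tens[OF x(2), of 1] by simp
      have "ej + E = ei" using E by simp
      then show "(\<gamma> \<otimes>\<^sub>m \<sigma>) *v ?Y = (complex_of_real (exp (- \<beta> * ei) / (1 + exp (- \<beta> * E))) / Z) *s ?Y"
        using G_tens[OF y(2), of 2] by simp
      show "selfadjoint (mat 1 \<otimes>\<^sub>m sigma_z)"
        by (intro selfadjoint_tensor selfadjoint_mat_1 selfadjoint_sigma_z)
      show "(mat 1 \<otimes>\<^sub>m sigma_z) *v ?X = ?X" "(mat 1 \<otimes>\<^sub>m sigma_z) *v ?Y = - ?Y"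
        by (simp_all add: tensor_mult_tens z_axis z_def) (simp add: vec_eq_iff tens_def)
    qed
    have "trace ((\<rho> \<otimes>\<^sub>m \<sigma>) ** (mat 1 \<otimes>\<^sub>m sigma_z)) = trace (\<sigma> ** sigma_z)"
      by (simp add: tensor_mult trace_tensor sa(3))
    moreover have "braket (tens v (axis q 1)) ((\<rho> \<otimes>\<^sub>m \<sigma>) *v tens v (axis q 1))
        = complex_of_real (p v * w q)" for v q
      by (simp add: tensor_mult_tens \<sigma>_axis braket_tens braket_simps axis_orth \<rho>_diag)
    moreover have "p x * w 1 < p y * w 2"
      using mult_strict_right_mono[OF less w_pos[of 1]] by (simp add: w2 mult_ac)
    ultimately show "can_cool \<rho> \<gamma> (qubit_gibbs \<beta> E)"
      unfolding can_cool_def \<sigma>_def[symmetric] using u tr by (intro exI[of _ u]) simp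
  next
    assume "can_cool \<rho> \<gamma> (qubit_gibbs \<beta> E)"
    then obtain u where u: "unitary u" "u ** (\<gamma> \<otimes>\<^sub>m \<sigma>) = (\<gamma> \<otimes>\<^sub>m \<sigma>) ** u"
      and cool: "Re (trace (u ** (\<rho> \<otimes>\<^sub>m \<sigma>) ** hconj u ** (mat 1 \<otimes>\<^sub>m sigma_z)))
        > Re (trace (\<sigma> ** sigma_z))"
      by (auto simp: can_cool_def \<sigma>_def)
    obtain B e where B: "onb B id UNIV"
      and e: "\<And>b. b \<in> B \<Longrightarrow> H *v b = complex_of_real (e b) *s b"
      and off: "\<And>b c. b \<in> B \<Longrightarrow> c \<in> B \<Longrightarrow> b \<noteq> c \<Longrightarrow> e b = e c \<Longrightarrow> braket b (\<rho> *v c) = 0"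
      using exists_adapted_eigenbasis[OF H sa(1)] by metis
    have unit: "norm b = 1" if "b \<in> B" for b
      using onbD(3)[OF B that that] by (simp add: norm_one_iff_braket)
    show "\<exists>x ei y ej. unit_eigenvector H ei x \<and> unit_eigenvector H ej y \<and> ei \<noteq> ej \<and> ei - ej = E \<and>
       rel_inv_temp \<rho> x ei y ej > \<beta>"
    proof (rule ccontr)
      assume none: "\<not> ?thesis"
      have le: "p c * exp (- \<beta> * E) \<le> p b" if "b \<in> B" "c \<in> B" "e b - e c = E" for b c
      proof -
        have "unit_eigenvector H (e b) b" "unit_eigenvector H (e c) c"
          using that e unit by (simp_all add: unit_eigenvector_def)
        moreover have "e b \<noteq> e c" using that(3) assms(5) by auto
        ultimately have "\<not> rel_inv_temp \<rho> b (e b) c (e c) > \<beta>" using none that(3) by blast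
        then show ?thesis
          using temp[OF unit[OF that(1)] unit[OF that(2)] that(3)] by simp
      qed
      define I where "I = B \<times> (UNIV :: 2 set)"
      define f where "f = (\<lambda>(b :: complex^'n, q :: 2). tens (id b) (axis q 1 :: complex^2))"
      define t where "t = (\<lambda>(b, q :: 2). e b + (if q = 1 then 0 else E))"
      define s where "s = (\<lambda>(b :: complex^'n, q). z q)"
      define r where "r = (\<lambda>(b, q). p b * w q)"
      define g where "g = (\<lambda>a. complex_of_real (exp (- \<beta> * t a) / (1 + exp (- \<beta> * E))) / Z)"
      have f: "onb I f UNIV"
        unfolding I_def f_def by (rule onb_tens[OF B onb_axis])
      have Gf: "(\<gamma> \<otimes>\<^sub>m \<sigma>) *v f a = g a *s f a" if "a \<in> I" for a
        using that G_tens[OF e] by (auto simp: I_def f_def g_def t_def)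
      have "Re (trace (u ** (\<rho> \<otimes>\<^sub>m \<sigma>) ** hconj u ** (mat 1 \<otimes>\<^sub>m sigma_z))) \<le> (\<Sum>a\<in>I. s a * r a)"
      proof (rule energy_conserving_trace_le[OF f u(1), where t = t])
        fix a b assume a: "a \<in> I" and b: "b \<in> I"
        show "braket (f a) (u *v f b) = 0" if "t a \<noteq> t b"
        proof -
          \<comment> \<open>The commutation relation is evaluated between two eigenvectors of
            \<open>\<gamma> \<otimes>\<^sub>m \<sigma>\<close>.\<close>
          have "g b * braket (f a) (u *v f b) = braket (f a) ((u ** (\<gamma> \<otimes>\<^sub>m \<sigma>)) *v f b)"
            by (simp add: Gf[OF b] matrix_vector_mult_scale braket_simps flip: matrix_vector_mul_assoc)
          also have "\<dots> = braket ((\<gamma> \<otimes>\<^sub>m \<sigma>) *v f a) (u *v f b)"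
            by (simp add: u(2) braket_selfadjoint[OF G] flip: matrix_vector_mul_assoc)
          also have "\<dots> = g a * braket (f a) (u *v f b)"
            using selfadjoint_eigenvalue_real[OF G Gf[OF a]] onbD(3)[OF f a a]
            by (simp add: Gf[OF a] braket_simps)
          finally have "g a = g b \<or> braket (f a) (u *v f b) = 0" by auto
          \<comment> \<open>Here \<open>\<beta> \<noteq> 0\<close> enters: it makes the Boltzmann
            factor injective in the energy, so commuting with the equilibrium state forces energy
            conservation.\<close>
          moreover have "g a \<noteq> g b"
            using that assms(1) den \<open>Z \<noteq> 0\<close> by (simp add: g_def del: of_real_divide)
          ultimately show ?thesis by simp
        qed
        show "braket (f a) ((\<rho> \<otimes>\<^sub>m \<sigma>) *v f b) = (if a = b then complex_of_real (r a) else 0)"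
          if "t a = t b"
        proof -
          obtain c q d q' where c: "a = (c, q)" "c \<in> B" and d: "b = (d, q')" "d \<in> B"
            using a b by (auto simp: I_def)
          \<comment> \<open>Equal qubit indices and equal total energies give \<open>c\<close> and
            \<open>d\<close> the same energy, where the adapted basis makes \<open>\<rho>\<close>
            diagonal. For different qubit indices the qubit factor vanishes, since
            \<open>\<sigma>\<close> is diagonal.\<close>
          have "braket c (\<rho> *v d) = (if c = d then complex_of_real (p c) else 0)" if "q = q'"
            using off[OF c(2) d(2)] that \<open>t a = t b\<close> by (auto simp: c d t_def \<rho>_diag)
          then show ?thesis
            by (auto simp: c d f_def r_def tensor_mult_tens \<sigma>_axis braket_tens braket_simps
                axis_orth)
        qed
        show "r b \<le> r a" if ab: "t a = t b" "s a = 1" "s b = - 1"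
        proof -
          obtain c d where c: "a = (c, 1)" "c \<in> B" and d: "b = (d, 2)" "d \<in> B"
            using ab(2,3) a b exhaust_2[of "snd a"] exhaust_2[of "snd b"]
            by (cases a; cases b) (auto simp: s_def z_def I_def split: if_splits)
          then have "e c - e d = E" using ab(1) by (simp add: t_def)
          from mult_right_mono[OF le[OF c(2) d(2) this], of "w 1"] show ?thesis
            using w_pos[of 1] by (simp add: c d r_def w2 mult_ac)
        qed
      next
        fix a assume a: "a \<in> I"
        show "(mat 1 \<otimes>\<^sub>m sigma_z) *v f a = complex_of_real (s a) *s f a"
          using tens_scale[of 1] by (simp add: f_def s_def tensor_mult_tens z_axis split_beta)
        show "s a = 1 \<or> s a = - 1" by (simp add: s_def z_def split_beta)
        show "0 \<le> r a"
          using a p_pos[OF unit] w_pos by (auto simp: r_def I_def intro!: mult_nonneg_nonneg less_imp_le)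
      qed
      \<comment> \<open>As \<open>trace \<rho> = 1\<close>, the bound equals the initial value
        \<open>trace (\<sigma> ** sigma_z)\<close>, which contradicts cooling.\<close>
      also have "(\<Sum>a\<in>I. s a * r a) = (\<Sum>b\<in>B. p b) * (w 1 - w 2)"
      proof -
        have "(\<Sum>a\<in>I. s a * r a) = (\<Sum>b\<in>B. \<Sum>q\<in>UNIV. z q * (p b * w q))"
          unfolding I_def sum.cartesian_product by (rule sum.cong) (auto simp: s_def r_def)
        then show ?thesis by (simp add: z_def sum_2 sum_distrib_right right_diff_distrib sum_subtractf)
      qed
      also have "(\<Sum>b\<in>B. p b) = Re (trace \<rho>)"
        by (simp add: onb_trace[OF B] p_def)
      finally show False using cool by (simp add: tr_\<sigma> sa(3))
    qed
  qed
qed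

end
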